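(* Let $R$ be a ring and let $G$ be a locally finite group. Then the group ring $RG$ is a CUNC-ring if and only if $R$ is a CUNC-ring and $G$ is a $2$-group.
   Context: All rings are associative and contain an identity element (not necessarily commutative). $U(S)$, $\mathrm{nil}(S)$, $\mathrm{idem}(S)$ denote the sets of units, nilpotents and idempotents of a ring $S$. An element $r\in S$ is clean if $r=u+e$ for some $u\in U(S)$ and $e\in\mathrm{idem}(S)$. An element $r\in S$ is uniquely nil-clean if there is exactly one pair $(q,e)\in\mathrm{nil}(S)\times\mathrm{idem}(S)$ with $r=q+e$. $S$ is a CUNC-ring if every clean element of $S$ is uniquely nil-clean. $RG$ denotes the group ring of $G$ over $R$. A group is locally finite if each of its finitely generated subgroups is finite. A group is a $2$-group if every element has order a power of $2$. *)

theory Defs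
  imports Complex_Main "HOL-Library.Poly_Mapping"
begin

text \<open>
  Rings are types of class \<open>ring_1\<close> (associative, with identity, not necessarily commutative,
  and with \<open>0 \<noteq> 1\<close>). Groups are types of class \<open>group_add\<close>, the additively written but not
  necessarily commutative groups of HOL.
\<close>

subsection \<open>Rings\<close>

text \<open>Units are two-sided; for noncommutative rings \<open>u dvd 1\<close> would only say that \<open>u\<close> has a
  right inverse.\<close>

definition ring_units :: "'a::ring_1 set"
  where "ring_units = {u. \<exists>v. u * v = 1 \<and> v * u = 1}"

definition ring_nil :: "'a::ring_1 set"
  where "ring_nil = {q. \<exists>n::nat. q ^ n = 0}"

definition ring_idem :: "'a::ring_1 set"
  where "ring_idem = {e. e * e = e}"

definition clean :: "'a::ring_1 \<Rightarrow> bool"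
  where "clean r \<longleftrightarrow> (\<exists>u \<in> ring_units. \<exists>e \<in> ring_idem. r = u + e)"

definition uniquely_nil_clean :: "'a::ring_1 \<Rightarrow> bool"
  where "uniquely_nil_clean r \<longleftrightarrow> (\<exists>!p. p \<in> ring_nil \<times> ring_idem \<and> r = fst p + snd p)"

definition CUNC_ring :: "'a::ring_1 itself \<Rightarrow> bool"
  where "CUNC_ring _ \<longleftrightarrow> (\<forall>r::'a. clean r \<longrightarrow> uniquely_nil_clean r)"

subsection \<open>Groups\<close>

definition is_subgroup :: "'g::group_add set \<Rightarrow> bool"
  where "is_subgroup H \<longleftrightarrow> 0 \<in> H \<and> (\<forall>x\<in>H. \<forall>y\<in>H. x + y \<in> H) \<and> (\<forall>x\<in>H. - x \<in> H)"

text \<open>\<open>is_subgroup hull S\<close>, the intersection of all subgroups containing \<open>S\<close>, is the subgroup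
  generated by \<open>S\<close>.\<close>

lemma is_subgroup_hull: "is_subgroup (is_subgroup hull S)"
  by (auto simp: hull_def is_subgroup_def)

definition locally_finite_group :: "'g::group_add itself \<Rightarrow> bool"
  where "locally_finite_group _ \<longleftrightarrow>
    (\<forall>S::'g set. finite S \<longrightarrow> finite (is_subgroup hull S))"

text \<open>The \<open>n\<close>-th multiple of \<open>g\<close>, i.e. its \<open>n\<close>-th power in multiplicative notation, is
  \<open>((+) g ^^ n) 0\<close>. Elements of infinite order get order \<open>0\<close>, which is not a power of \<open>2\<close>.\<close>

definition element_order :: "'g::group_add \<Rightarrow> nat"
  where "element_order g =
    (if \<exists>n>0. ((+) g ^^ n) 0 = 0 then LEAST n. n > 0 \<and> ((+) g ^^ n) 0 = 0 else 0)"

definition two_group :: "'g::group_add itself \<Rightarrow> bool"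
  where "two_group _ \<longleftrightarrow> (\<forall>g::'g. \<exists>k. element_order g = 2 ^ k)"

subsection \<open>Group rings\<close>

text \<open>The finitely supported functions from \<open>'g\<close> to \<open>'r\<close>, with pointwise addition and the
  convolution product of \<^theory>\<open>HOL-Library.Poly_Mapping\<close>, where
  \<open>single g a * single h b = single (g + h) (a * b)\<close>.\<close>

type_synonym ('r, 'g) group_ring = "'g \<Rightarrow>\<^sub>0 'r"

end

theory Submission
  imports Defs "HOL-Algebra.Sylow" "HOL-Algebra.Multiplicative_Group"
begin

text \<open>
  A ring is CUNC iff its idempotents are central and its units are exactly \<open>1\<close> plus nilpotents;
  then \<open>2 = 1 - (-1)\<close> is nilpotent. Both conditions pass from \<open>RG\<close> to \<open>R\<close>. For \<open>g\<close> in \<open>G\<close>, the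
  element \<open>g - 1\<close> of \<open>RG\<close> is nilpotent, and \<open>g^(2^n) - 1\<close> is congruent to \<open>(g - 1)^(2^n)\<close> modulo
  \<open>2\<close>, so \<open>g^(2^n) - 1\<close> lies in \<open>2RG\<close> for some \<open>n\<close>, which forces \<open>g^(2^n) = 1\<close>.

  Conversely, the augmentation ideal of \<open>RG\<close> is nil: by local finiteness it suffices to treat a
  finite 2-group, where the augmentation ideal is nilpotent by induction along subgroups of index
  two. Units and idempotents of \<open>RG\<close> are then controlled by their augmentations: the unit \<open>u\<close> has
  \<open>u - 1\<close> nilpotent modulo a nil ideal, and an idempotent equals its augmentation, since the two
  commute and differ by a nilpotent.
\<close>

subsection \<open>CUNC-rings\<close>

lemma ring_nil_power_ge:
  fixes q :: "'a::ring_1"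
  assumes "q ^ m = 0" "m \<le> n"
  shows "q ^ n = 0"
  using assms by (metis le_add_diff_inverse mult_zero_left power_add)

text \<open>As 2 is central, powers of \<open>a + 2 * y\<close> agree with those of \<open>a\<close>
  modulo 2. So \<open>(a + 2 * y) ^ n\<close> is a multiple of 2 once \<open>a ^ n = 0\<close>, and
  multiples of 2 are nilpotent together with 2.\<close>

lemma ring_nil_add_two_times:
  fixes a y :: "'a::ring_1"
  assumes "a \<in> ring_nil" "(2::'a) \<in> ring_nil"
  shows "a + 2 * y \<in> ring_nil"
proof -
  obtain n k where n: "a ^ n = 0" and k: "(2::'a) ^ k = 0"
    using assms by (auto simp: ring_nil_def)
  have two: "2 * z = z * 2" for z :: 'a
    by (simp add: mult_2 mult_2_right)
  have "\<exists>z. (a + 2 * y) ^ j = a ^ j + 2 * z" for j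
  proof (induction j)
    case 0
    show ?case by (rule exI[of _ 0]) simp
  next
    case (Suc j)
    then obtain z where z: "(a + 2 * y) ^ j = a ^ j + 2 * z" by blast
    have "(a + 2 * y) * (a ^ j + 2 * z) = a * a ^ j + 2 * (a * z + y * a ^ j + 2 * (y * z))"
      by (simp add: algebra_simps mult_2 mult_2_right)
    then show ?case using z by (metis power_Suc)
  qed
  then obtain z where "(a + 2 * y) ^ n = 2 * z"
    using n by (metis add_0)
  moreover have "(2 * z) ^ j = 2 ^ j * z ^ j" for j
  proof (induction j)
    case (Suc j)
    have "(2 * z) ^ Suc j = 2 * (z * 2 ^ j) * z ^ j" using Suc by (simp add: mult.assoc)
    also have "z * 2 ^ j = 2 ^ j * z"
      using power_commuting_commutes[of 2 z j] two by simp
    finally show ?case by (simp add: mult.assoc)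
  qed simp
  ultimately have "(a + 2 * y) ^ (n * k) = 0"
    using k by (simp add: power_mult)
  then show ?thesis by (auto simp: ring_nil_def)
qed

lemma one_minus_nil_unit:
  fixes q :: "'a::ring_1"
  assumes "q \<in> ring_nil"
  shows "1 - q \<in> ring_units"
proof -
  obtain n where n: "q ^ n = 0" using assms by (auto simp: ring_nil_def)
  \<comment> \<open>The witness \<open>s\<close> is the geometric sum of the powers of
    \<open>q\<close> below \<open>j\<close>; for \<open>j = n\<close> it is the inverse.\<close>
  have "\<exists>s. (1 - q) * s = 1 - q ^ j \<and> s * (1 - q) = 1 - q ^ j" for j
  proof (induction j)
    case 0
    show ?case by (rule exI[of _ 0]) simp
  next
    case (Suc j)
    then obtain s where "(1 - q) * s = 1 - q ^ j" "s * (1 - q) = 1 - q ^ j" by blast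
    then have "(1 - q) * (s + q ^ j) = 1 - q ^ Suc j \<and> (s + q ^ j) * (1 - q) = 1 - q ^ Suc j"
      by (simp only: distrib_left distrib_right)
        (simp add: left_diff_distrib right_diff_distrib power_commutes)
    then show ?case by blast
  qed
  from this[of n] show ?thesis using n by (auto simp: ring_units_def)
qed

text \<open>Multiplication by a central idempotent \<open>f\<close> is a ring homomorphism onto the
  corner with identity \<open>f\<close>. The outer factor \<open>f\<close> makes the case
  \<open>n = 0\<close> correct.\<close>

lemma central_idem_times_power:
  fixes f :: "'a::ring_1"
  assumes "f * f = f" "\<And>x. f * x = x * f"
  shows "f * (f * x) ^ n = f * x ^ n"
proof (induction n)
  case (Suc n)
  have "f * (f * x) ^ Suc n = f * (f * x) * (f * x) ^ n"
    by (simp add: mult.assoc)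
  also have "\<dots> = f * x * (f * x) ^ n"
    using assms(1) by (metis mult.assoc)
  also have "\<dots> = x * (f * (f * x) ^ n)"
    using assms(2) by (metis mult.assoc)
  also have "\<dots> = f * x ^ Suc n"
    using assms(2) Suc by (metis mult.assoc power_Suc)
  finally show ?case .
qed simp

text \<open>In the corner cut out by \<open>f\<close>, the image of \<open>u\<close> is a unit and
  that of \<open>q\<close> is nilpotent. If they coincide, the corner is zero.\<close>

lemma central_idem_eq_zero:
  fixes f :: "'a::ring_1"
  assumes f: "f * f = f" "\<And>x. f * x = x * f"
    and "u \<in> ring_units" "q \<in> ring_nil" "f * u = f * q"
  shows "f = 0"
proof -
  obtain n where n: "q ^ n = 0" using assms(4) by (auto simp: ring_nil_def)
  obtain v where v: "u * v = 1" "v * u = 1" using assms(3) by (auto simp: ring_units_def)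
  have "f * u ^ n = f * q ^ n"
    using central_idem_times_power[OF f, of u n] central_idem_times_power[OF f, of q n] assms(5)
    by simp
  then have "f * u ^ n * v ^ n = 0"
    using n by simp
  moreover have "u ^ n * v ^ n = 1"
    using v(1) by (rule left_right_inverse_power)
  ultimately show ?thesis by (simp add: mult.assoc)
qed

lemma idem_clean:
  fixes f :: "'a::ring_1"
  assumes "f \<in> ring_idem"
  shows "clean f"
proof -
  have ff: "f * f = f" using assms by (simp add: ring_idem_def)
  have "(2 * f - 1) * (2 * f - 1) = 1"
    by (simp add: algebra_simps mult_2 mult_2_right ff)
  then have "2 * f - 1 \<in> ring_units" by (auto simp: ring_units_def)
  moreover have "1 - f \<in> ring_idem" by (simp add: ring_idem_def algebra_simps ff)
  moreover have "f = (2 * f - 1) + (1 - f)" by (simp add: mult_2)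
  ultimately show ?thesis unfolding clean_def by blast
qed

lemma two_nil:
  assumes "\<forall>u\<in>ring_units. (u::'a::ring_1) - 1 \<in> ring_nil"
  shows "(2::'a) \<in> ring_nil"
proof -
  have "(-1::'a) \<in> ring_units" by (auto simp: ring_units_def intro: exI[of _ "-1"])
  then have "(-1::'a) - 1 \<in> ring_nil" using assms by blast
  then obtain k where "(- (2::'a)) ^ k = 0" by (auto simp: ring_nil_def)
  then have "(2::'a) ^ k = 0"
    by (cases "even k") (simp_all add: power_minus_even power_minus_odd)
  then show ?thesis by (auto simp: ring_nil_def)
qed

section \<open>Characterization of CUNC-rings by units and idempotents\<close>

lemma CUNC_ring_iff:
  "CUNC_ring TYPE('a::ring_1) \<longleftrightarrow>
    (\<forall>u\<in>ring_units. (u::'a) - 1 \<in> ring_nil) \<and> (\<forall>e\<in>ring_idem. \<forall>x::'a. e * x = x * e)"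
  (is "_ \<longleftrightarrow> ?units \<and> ?abelian")
proof
  assume cunc: "CUNC_ring TYPE('a)"
  have uniq: "q = q' \<and> e = e'"
    if "clean (q + e)" "q \<in> ring_nil" "q' \<in> ring_nil" "e \<in> ring_idem" "e' \<in> ring_idem"
      "q + e = q' + e'" for q q' e e' :: 'a
  proof -
    have "\<exists>!p. p \<in> ring_nil \<times> ring_idem \<and> q + e = fst p + snd p"
      using cunc that(1) by (auto simp: CUNC_ring_def uniquely_nil_clean_def)
    then have "(q, e) = (q', e')"
      using that by (metis (no_types, lifting) SigmaI fst_conv snd_conv)
    then show ?thesis by simp
  qed
  \<comment> \<open>With \<open>d = e * x * (1 - e)\<close>, which squares to zero,
    \<open>e + d\<close> is again idempotent. Hence the clean element \<open>e + d\<close> has the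
    nil-clean decompositions \<open>0 + (e + d)\<close> and \<open>d + e\<close>, and uniqueness
    gives \<open>d = 0\<close>.\<close>
  have corner: "e * x * (1 - e) = 0" if e: "e \<in> ring_idem" for e x :: 'a
  proof -
    have ee: "e * e = e" using e by (simp add: ring_idem_def)
    have ee': "e * (e * z) = e * z" for z using ee by (metis mult.assoc)
    let ?d = "e * x * (1 - e)"
    have ed: "e * ?d = ?d" "?d * e = 0" "?d * ?d = 0"
      by (simp_all add: algebra_simps ee ee')
    have "e + ?d \<in> ring_idem"
      unfolding ring_idem_def by (simp only: mem_Collect_eq distrib_left distrib_right ed ee) simp
    moreover from this have "clean (e + ?d)" by (rule idem_clean)
    moreover have "?d \<in> ring_nil"
      unfolding ring_nil_def using ed(3) by (auto simp: power2_eq_square intro: exI[of _ 2])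
    moreover have "(0::'a) \<in> ring_nil"
      by (auto simp: ring_nil_def intro: exI[of _ 1])
    ultimately have "0 = ?d"
      using uniq[of 0 "e + ?d" ?d e] e by (simp add: add.commute)
    then show ?thesis by simp
  qed
  \<comment> \<open>Vanishing of both off-diagonal Peirce components, for \<open>e\<close> and for
    \<open>1 - e\<close>, gives \<open>e * x = e * x * e = x * e\<close>.\<close>
  have abelian: "e * x = x * e" if e: "e \<in> ring_idem" for e x :: 'a
  proof -
    have "e * e = e" using e by (simp add: ring_idem_def)
    moreover from this have "1 - e \<in> ring_idem" by (simp add: ring_idem_def algebra_simps)
    ultimately show ?thesis
      using corner[OF e, of x] corner[of "1 - e" x] by (simp add: algebra_simps)
  qed
  moreover have "u - 1 \<in> ring_nil" if u: "u \<in> ring_units" for u :: 'a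
  proof -
    have "(0::'a) \<in> ring_idem" by (simp add: ring_idem_def)
    then have "clean u" using u unfolding clean_def by (metis add.right_neutral)
    then have "uniquely_nil_clean u" using cunc by (simp add: CUNC_ring_def)
    then obtain p where "p \<in> ring_nil \<times> ring_idem" "u = fst p + snd p"
      unfolding uniquely_nil_clean_def by blast
    then obtain q e where qe: "q \<in> ring_nil" "e \<in> ring_idem" "u = q + e"
      by (metis mem_Times_iff)
    have ee: "e * e = e" using qe(2) by (simp add: ring_idem_def)
    \<comment> \<open>On the corner of \<open>1 - e\<close> the unit \<open>u = q + e\<close> agrees
      with the nilpotent \<open>q\<close>.\<close>
    have "1 - e = 0"
    proof (rule central_idem_eq_zero[OF _ _ u qe(1)])
      show "(1 - e) * (1 - e) = 1 - e" by (simp add: algebra_simps ee)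
      show "(1 - e) * x = x * (1 - e)" for x
        using abelian[OF qe(2)] by (simp add: algebra_simps)
      show "(1 - e) * u = (1 - e) * q" by (simp add: qe(3) algebra_simps ee)
    qed
    then show ?thesis using qe by simp
  qed
  ultimately show "?units \<and> ?abelian" by blast
next
  assume H: "?units \<and> ?abelian"
  then have two: "(2::'a) \<in> ring_nil" by (blast intro: two_nil)
  have le: "e' * (1 - e) = 0"
    if "q \<in> ring_nil" "q' \<in> ring_nil" "e \<in> ring_idem" "e' \<in> ring_idem" "q + e = q' + e'"
    for q q' e e' :: 'a
  proof -
    have ee: "e * e = e" "e' * e' = e'" using that by (auto simp: ring_idem_def)
    have c: "e * x = x * e" "e' * x = x * e'" for x using H that by blast+
    have c': "(1 - e) * x = x * (1 - e)" for x
      by (simp add: left_diff_distrib right_diff_distrib c(1)[of x])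
    have e1: "(1 - e) * (1 - e) = 1 - e" by (simp add: algebra_simps ee)
    \<comment> \<open>On the corner of the central idempotent \<open>e' * (1 - e)\<close>,
      \<open>e'\<close> acts as 1 and \<open>e\<close> as 0, so \<open>q + e = q' + e'\<close> reads
      \<open>q = q' + 1\<close>. There the unit \<open>1 - q\<close> equals the nilpotent
      \<open>- q'\<close>, so the corner is zero.\<close>
    have "e' * (1 - e) * (1 - q) = e' * (1 - e) * (- q')"
    proof -
      have q: "q = q' + e' - e" using that(5) by (simp add: algebra_simps)
      have "e' * (1 - e) * e' = e' * (1 - e)"
        by (metis c(2) ee(2) mult.assoc)
      moreover have "e' * (1 - e) * e = 0"
        by (simp add: algebra_simps ee)
      ultimately show ?thesis
        unfolding q by (simp add: right_diff_distrib distrib_left)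
    qed
    moreover have "- q' \<in> ring_nil"
      using that(2) by (simp add: ring_nil_def power_minus[of q']) (metis mult_zero_right)
    moreover have "e' * (1 - e) * (e' * (1 - e)) = e' * (1 - e)"
      using c' ee(2) e1 by (metis mult.assoc)
    moreover have "e' * (1 - e) * x = x * (e' * (1 - e))" for x
      using c(2) c' by (metis mult.assoc)
    ultimately show ?thesis
      using central_idem_eq_zero[OF _ _ one_minus_nil_unit[OF that(1)]] by blast
  qed
  have "uniquely_nil_clean r" if "clean r" for r :: 'a
  proof -
    obtain u e where ue: "u \<in> ring_units" "e \<in> ring_idem" "r = u + e"
      using \<open>clean r\<close> by (auto simp: clean_def)
    \<comment> \<open>Replacing \<open>e\<close> by its complement turns \<open>u + e\<close> into a
      nil-clean sum: the difference \<open>e - (1 - e)\<close> contributes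
      \<open>2 * e - 1\<close>.\<close>
    have "u - 1 + 2 * e \<in> ring_nil"
      using H ue(1) two by (blast intro: ring_nil_add_two_times)
    moreover have "1 - e \<in> ring_idem"
      using ue(2) by (simp add: ring_idem_def algebra_simps)
    moreover have "r = (u - 1 + 2 * e) + (1 - e)" by (simp add: ue(3) mult_2)
    ultimately have "\<exists>p. p \<in> ring_nil \<times> ring_idem \<and> r = fst p + snd p"
      by (metis SigmaI fst_conv snd_conv)
    moreover have "p = p'"
      if "p \<in> ring_nil \<times> ring_idem" "r = fst p + snd p"
        "p' \<in> ring_nil \<times> ring_idem" "r = fst p' + snd p'" for p p'
    proof -
      have m: "fst p \<in> ring_nil" "fst p' \<in> ring_nil" "snd p \<in> ring_idem" "snd p' \<in> ring_idem"
        "fst p + snd p = fst p' + snd p'"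
        using that by auto
      \<comment> \<open>By symmetry each of the two idempotents absorbs the other; since they
        commute, they are equal.\<close>
      from le[OF m(1-5)] le[OF m(2) m(1) m(4) m(3) m(5)[symmetric]]
      have "snd p' = snd p' * snd p" "snd p = snd p * snd p'"
        by (simp_all add: right_diff_distrib)
      then have "snd p = snd p'" using H m(3) by metis
      then show ?thesis using m(5) by (simp add: prod_eq_iff)
    qed
    ultimately show ?thesis unfolding uniquely_nil_clean_def by blast
  qed
  then show "CUNC_ring TYPE('a)" by (simp add: CUNC_ring_def)
qed

subsection \<open>Finite 2-groups\<close>

text \<open>Bridge from the type class to the carrier-based groups of HOL-Algebra, which provide
  Sylow's theorem and element orders.\<close>

definition subgroup_monoid :: "'g::group_add set \<Rightarrow> 'g monoid"
  where "subgroup_monoid H = \<lparr>carrier = H, monoid.mult = (+), one = 0\<rparr>"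

lemma group_subgroup_monoid:
  assumes "is_subgroup H"
  shows "group (subgroup_monoid H)"
  by (rule groupI)
    (use assms in \<open>auto simp: subgroup_monoid_def is_subgroup_def add.assoc intro: left_minus\<close>)

lemma funpow_add_left: "((+) x ^^ n) y = ((+) x ^^ n) 0 + (y::'g::monoid_add)"
  by (induction n) (simp_all add: add.assoc)

lemma subgroup_monoid_pow: "x [^]\<^bsub>subgroup_monoid H\<^esub> (n::nat) = ((+) x ^^ n) 0"
  by (induction n)
    (simp_all add: nat_pow_def subgroup_monoid_def funpow_swap1 funpow_add_left[of _ x x])

lemma subgroup_monoid_inv:
  assumes "is_subgroup H" "x \<in> H"
  shows "inv\<^bsub>subgroup_monoid H\<^esub> x = - x"
proof -
  interpret group "subgroup_monoid H" by (rule group_subgroup_monoid) fact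
  show ?thesis
    by (rule inv_equality) (use assms in \<open>auto simp: subgroup_monoid_def is_subgroup_def\<close>)
qed

lemma subgroup_of_subgroup_monoid:
  assumes "is_subgroup H" "subgroup N (subgroup_monoid H)"
  shows "is_subgroup N" "N \<subseteq> H"
proof -
  show sub: "N \<subseteq> H" using subgroup.subset[OF assms(2)] by (simp add: subgroup_monoid_def)
  have "- x \<in> N" if "x \<in> N" for x
    using subgroup.m_inv_closed[OF assms(2) that] subgroup_monoid_inv[OF assms(1)] sub that by auto
  then show "is_subgroup N"
    using subgroup.one_closed[OF assms(2)] subgroup.m_closed[OF assms(2)]
    by (simp add: is_subgroup_def subgroup_monoid_def)
qed

text \<open>\<open>element_order\<close> coincides with \<open>ord\<close> of HOL-Algebra; both are
  0 for infinite order, where \<open>0 dvd n\<close> correctly leaves only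
  \<open>n = 0\<close>.\<close>

lemma funpow_add_eq_0_iff:
  fixes g :: "'g::group_add"
  shows "((+) g ^^ n) 0 = 0 \<longleftrightarrow> element_order g dvd n"
proof -
  have ug: "is_subgroup (UNIV :: 'g set)" by (simp add: is_subgroup_def)
  interpret group "subgroup_monoid (UNIV :: 'g set)"
    using ug by (rule group_subgroup_monoid)
  have z: "((+) g ^^ n) 0 = 0 \<longleftrightarrow> ord g dvd n" for n
    using pow_eq_id[of g n] unfolding subgroup_monoid_pow by (simp add: subgroup_monoid_def)
  have "element_order g = ord g"
  proof (cases "\<exists>n>0. ((+) g ^^ n) 0 = 0")
    case True
    then have "ord g > 0" by (metis z dvd_0_left_iff gr0I)
    have "(LEAST n. n > 0 \<and> ((+) g ^^ n) 0 = 0) = ord g"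
      by (rule Least_equality) (use \<open>ord g > 0\<close> in \<open>auto simp: z intro: dvd_imp_le\<close>)
    then show ?thesis using True by (simp add: element_order_def)
  next
    case False
    then have "ord g = 0" by (metis z dvd_refl gr0I)
    then show ?thesis using False by (simp only: element_order_def if_False)
  qed
  then show ?thesis using z by simp
qed

text \<open>Cauchy's theorem: a prime divisor \<open>p\<close> of \<open>card H\<close> yields a
  nonzero element whose order divides \<open>p\<close>. That order is a power of 2 other than 1, so
  \<open>p = 2\<close>.\<close>

lemma card_two_subgroup:
  fixes H :: "'g::group_add set"
  assumes H: "is_subgroup H" "finite H" and two: "\<And>g. g \<in> H \<Longrightarrow> \<exists>k. element_order g = 2 ^ k"
  shows "\<exists>n. card H = 2 ^ n"
proof -
  interpret group "subgroup_monoid H" using H(1) by (rule group_subgroup_monoid)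
  have c: "carrier (subgroup_monoid H) = H" by (simp add: subgroup_monoid_def)
  have "card H \<noteq> 0" using H by (auto simp: is_subgroup_def)
  have "p = 2" if p: "prime p" "p dvd card H" for p :: nat
  proof -
    \<comment> \<open>The exponent 1 makes Sylow's theorem supply a subgroup of order exactly
      \<open>p\<close>; \<open>m\<close> may still be divisible by \<open>p\<close>.\<close>
    from p obtain m where "card H = p ^ 1 * m" by (auto simp: dvd_def)
    then obtain P where P: "subgroup P (subgroup_monoid H)" "card P = p"
      using sylow_thm[OF p(1) is_group, of 1 m] H(2) by (auto simp: order_def c)
    note P' = subgroup_of_subgroup_monoid[OF H(1) P(1)]
    have "P \<noteq> {0}" using P(2) p(1) by auto
    moreover have "0 \<in> P" using P'(1) by (simp add: is_subgroup_def)
    ultimately obtain x where x: "x \<in> P" "x \<noteq> 0" by auto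
    obtain k where k: "element_order x = 2 ^ k" using two x(1) P'(2) by blast
    interpret P: group "subgroup_monoid P" using P'(1) by (rule group_subgroup_monoid)
    have "((+) x ^^ p) 0 = 0"
      using P.pow_order_eq_1[of x] x(1) P(2) unfolding subgroup_monoid_pow
      by (simp add: subgroup_monoid_def order_def)
    then have "2 ^ k dvd p" using k by (simp add: funpow_add_eq_0_iff)
    moreover have "k \<noteq> 0"
      using k x(2) funpow_add_eq_0_iff[of 1 x] by auto
    ultimately have "2 dvd p" by (metis dvd_power dvd_trans gr0I)
    then show ?thesis using p(1) primes_dvd_imp_eq two_is_prime_nat by blast
  qed
  then have "prime_factors (card H) \<subseteq> {2}" by (auto simp: prime_factors_dvd)
  then show ?thesis
    using \<open>card H \<noteq> 0\<close> prime_factorization_nat[of "card H"]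
    by (metis (no_types) gr0I prod.empty prod.insert power_0 mult_1_right finite.emptyI
       subset_singletonD empty_iff)
qed

text \<open>Sylow's theorem for the non-maximal power \<open>2 ^ n\<close>, with cofactor 2, gives
  \<open>N\<close>. The remaining claims hold because \<open>H\<close> outside \<open>N\<close> is
  the single coset of \<open>t\<close>.\<close>

lemma index_two_subgroup:
  fixes H :: "'g::group_add set"
  assumes H: "is_subgroup H" "finite H" "card H = 2 ^ Suc n"
  obtains N t where "is_subgroup N" "card N = 2 ^ n" "N \<subseteq> H" "t \<in> H" "t + t \<in> N"
    "H = N \<union> (\<lambda>x. x + t) ` N" "\<And>x. x \<in> N \<Longrightarrow> t + x - t \<in> N" "\<And>x. x \<in> N \<Longrightarrow> - t + x + t \<in> N"
proof -
  interpret group "subgroup_monoid H" using H(1) by (rule group_subgroup_monoid)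
  obtain N where N: "subgroup N (subgroup_monoid H)" "card N = 2 ^ n"
    using sylow_thm[OF two_is_prime_nat is_group, of n 2] H
    by (auto simp: order_def subgroup_monoid_def)
  note N' = subgroup_of_subgroup_monoid[OF H(1) N(1)]
  have Nsub: "0 \<in> N" "\<And>x y. x \<in> N \<Longrightarrow> y \<in> N \<Longrightarrow> x + y \<in> N" "\<And>x. x \<in> N \<Longrightarrow> - x \<in> N"
    using N'(1) by (auto simp: is_subgroup_def)
  have Hsub: "\<And>x y. x \<in> H \<Longrightarrow> y \<in> H \<Longrightarrow> x + y \<in> H" "\<And>x. x \<in> H \<Longrightarrow> - x \<in> H"
    using H(1) by (auto simp: is_subgroup_def)
  have "N \<noteq> H" using N(2) H(3) by auto
  then obtain t where t: "t \<in> H" "t \<notin> N" using N'(2) by blast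
  have cl: "x \<in> N" if "x + y \<in> N" "y \<in> N" for x y
    using Nsub(2)[OF that(1) Nsub(3)[OF that(2)]] by (simp add: add.assoc)
  have cr: "y \<in> N" if "x + y \<in> N" "x \<in> N" for x y
    using Nsub(2)[OF Nsub(3)[OF that(2)] that(1)] by (simp flip: add.assoc)
  have "finite N" using N'(2) H(2) by (rule finite_subset)
  have "N \<inter> (\<lambda>x. x + t) ` N = {}" using t(2) cr by auto
  then have "card (N \<union> (\<lambda>x. x + t) ` N) = card H"
    using \<open>finite N\<close> N(2) H(3) by (simp add: card_Un_disjoint card_image)
  moreover have "N \<union> (\<lambda>x. x + t) ` N \<subseteq> H" using N'(2) Hsub t by auto
  ultimately have cov: "H = N \<union> (\<lambda>x. x + t) ` N"
    using H(2) by (metis card_subset_eq)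
  \<comment> \<open>Both elements lie in the coset of \<open>t\<close>, so \<open>t\<close> cancels.
    Applied to \<open>t\<close> and \<open>- t\<close> this gives \<open>t + t\<close>; applied to
    \<open>t + x\<close> and \<open>t\<close> it gives a conjugate of \<open>x\<close>.\<close>
  have diff: "x - y \<in> N" if "x \<in> H" "y \<in> H" "x \<notin> N" "y \<notin> N" for x y
  proof -
    from that cov obtain a b where "a \<in> N" "b \<in> N" "x = a + t" "y = b + t" by blast
    then show ?thesis using Nsub
      by (simp add: diff_conv_add_uminus minus_add add.assoc del: add_uminus_conv_diff)
  qed
  have tt: "t + t \<in> N"
    using diff[of t "- t"] t Hsub Nsub(3)[of "- t"] by auto
  have c1: "t + x - t \<in> N" if x: "x \<in> N" for x
    using diff[of "t + x" t] t cl[of t x] x N'(2) Hsub by auto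
  have "- t + x + t \<in> N" if x: "x \<in> N" for x
  proof (rule ccontr)
    assume "- t + x + t \<notin> N"
    moreover have "- t + x + t \<in> H" using t x N'(2) Hsub by auto
    ultimately obtain b where "b \<in> N" "- t + x + t = b + t" using cov by auto
    then have "- t + x \<in> N" by simp
    then have "- t \<in> N" using cl x by blast
    then show False using Nsub(3)[of "- t"] t(2) by simp
  qed
  then show ?thesis using that[OF N'(1) N(2) N'(2) t(1) tt cov c1] by blast
qed

subsection \<open>The augmentation ideal\<close>

definition aug :: "('r::ring_1, 'g) group_ring \<Rightarrow> 'r"
  where "aug x = (\<Sum>g\<in>Poly_Mapping.keys x. Poly_Mapping.lookup x g)"

lemma group_ring_induct [case_names zero single add]:
  fixes x :: "('r::ring_1, 'g) group_ring"
  assumes "P 0" "\<And>g r. P (Poly_Mapping.single g r)" "\<And>x y. P x \<Longrightarrow> P y \<Longrightarrow> P (x + y)"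
  shows "P x"
proof (induction x rule: update_induct)
  case const
  show ?case by (fact assms(1))
next
  case (update x g r)
  have "Poly_Mapping.update g r x = Poly_Mapping.single g r + x"
    using update.hyps
    by (intro poly_mapping_eqI) (auto simp: lookup_update lookup_add lookup_single in_keys_iff when_def)
  then show ?case using assms(2,3) update.IH by simp
qed

lemma aug_zero [simp]: "aug 0 = 0"
  by (simp add: aug_def)

lemma aug_single [simp]: "aug (Poly_Mapping.single g r) = r"
  by (simp add: aug_def)

lemma aug_one [simp]: "aug (1 :: ('r::ring_1, 'g::group_add) group_ring) = 1"
  by (metis aug_single single_one)

lemma aug_add: "aug (x + y) = aug x + aug y"
  unfolding aug_def by (rule setsum_keys_plus_distrib) simp_all

lemma aug_diff: "aug (x - y) = aug x - aug y"
  by (metis aug_add add_diff_cancel_right' diff_add_cancel)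

lemma aug_mult:
  fixes x y :: "('r::ring_1, 'g::group_add) group_ring"
  shows "aug (x * y) = aug x * aug y"
proof (induction x rule: group_ring_induct)
  case (single g r)
  show ?case
    by (induction y rule: group_ring_induct) (simp_all add: aug_add mult_single distrib_left)
qed (simp_all add: aug_add distrib_right)

lemma aug_power:
  fixes x :: "('r::ring_1, 'g::group_add) group_ring"
  shows "aug (x ^ n) = aug x ^ n"
  by (induction n) (simp_all add: aug_mult)

text \<open>For a subgroup \<open>H\<close>, the augmentation ideal of \<open>RH\<close>, kept
  inside \<open>RG\<close> so that the induction over subgroups stays in one type.\<close>

definition aug_ideal :: "'g set \<Rightarrow> ('r::ring_1, 'g) group_ring set"
  where "aug_ideal H = {x. Poly_Mapping.keys x \<subseteq> H \<and> aug x = 0}"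

section \<open>Nilpotency of the augmentation ideal of a finite 2-group\<close>

text \<open>The \<open>m\<close>-th power of \<open>S\<close> is zero. Products of different
  elements are included: nilpotency of single elements would be too weak for a noncommutative
  induction.\<close>

definition products_vanish :: "nat \<Rightarrow> 'a::ring_1 set \<Rightarrow> bool"
  where "products_vanish m S \<longleftrightarrow> (\<forall>xs. set xs \<subseteq> S \<and> length xs = m \<longrightarrow> prod_list xs = 0)"

text \<open>A product of \<open>c * m\<close> factors is cut into \<open>m\<close> blocks of length
  \<open>c\<close>, each of which lies in \<open>K\<close>.\<close>

lemma products_vanish_blocks:
  assumes "products_vanish m K" "\<And>xs. set xs \<subseteq> S \<Longrightarrow> length xs = c \<Longrightarrow> prod_list xs \<in> K"
  shows "products_vanish (c * m) S"
proof -
  have "\<exists>ys. set ys \<subseteq> K \<and> length ys = j \<and> prod_list ys = prod_list xs"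
    if "set xs \<subseteq> S" "length xs = c * j" for xs j
    using that
  proof (induction j arbitrary: xs)
    case 0
    then show ?case by simp
  next
    case (Suc j)
    have "set (drop c xs) \<subseteq> S" "length (drop c xs) = c * j"
      using Suc.prems set_drop_subset[of c xs] by auto
    then obtain ys where ys: "set ys \<subseteq> K" "length ys = j" "prod_list ys = prod_list (drop c xs)"
      using Suc.IH by blast
    have "prod_list (take c xs) \<in> K"
      using Suc.prems set_take_subset[of c xs] by (intro assms(2)) auto
    then show ?case
      using ys by (intro exI[of _ "prod_list (take c xs) # ys"])
        (simp flip: prod_list.append)
  qed
  then show ?thesis using assms(1) unfolding products_vanish_def by metis
qed

lemma products_vanish_extend:
  fixes t t' :: "'a::ring_1"
  assumes D: "products_vanish m D" and t: "t * t' = 1" and conj: "\<And>x. x \<in> D \<Longrightarrow> t' * x * t \<in> D"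
  shows "products_vanish m {a + b * t | a b. a \<in> D \<and> b \<in> D}"
proof -
  \<comment> \<open>\<open>A j\<close> consists of the elements killed by left multiplication with \<open>j\<close>-fold products from \<open>D\<close>.
    It is stable under \<open>t\<close>, so \<open>D + D t\<close> maps \<open>A (j + 1)\<close> to \<open>A j\<close>; and \<open>1\<close> lies in \<open>A m\<close>.\<close>
  define A where "A j = {y. \<forall>xs. set xs \<subseteq> D \<and> length xs = j \<longrightarrow> prod_list xs * y = 0}" for j
  have conj_prod: "prod_list xs * t = t * prod_list (map (\<lambda>x. t' * x * t) xs)" for xs
  proof (induction xs)
    case (Cons x xs)
    have "prod_list (x # xs) * t = t * t' * x * (prod_list xs * t)"
      using t by (simp add: mult.assoc)
    then show ?case using Cons by (simp add: mult.assoc)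
  qed simp
  have tA: "t * y \<in> A j" if "y \<in> A j" for y j
    unfolding A_def
  proof (intro CollectI allI impI)
    fix xs assume xs: "set xs \<subseteq> D \<and> length xs = j"
    then have "set (map (\<lambda>x. t' * x * t) xs) \<subseteq> D" using conj by auto
    then have "prod_list (map (\<lambda>x. t' * x * t) xs) * y = 0"
      using that xs by (simp add: A_def)
    then show "prod_list xs * (t * y) = 0" by (metis conj_prod mult.assoc mult_zero_right)
  qed
  have DA: "a * y \<in> A j" if "a \<in> D" "y \<in> A (Suc j)" for a y j
    unfolding A_def
  proof (intro CollectI allI impI)
    fix xs assume "set xs \<subseteq> D \<and> length xs = j"
    then have "prod_list (xs @ [a]) * y = 0"
      using that by (simp add: A_def del: prod_list.append)
    then show "prod_list xs * (a * y) = 0" by (simp add: mult.assoc)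
  qed
  have KA: "(a + b * t) * y \<in> A j" if "a \<in> D" "b \<in> D" "y \<in> A (Suc j)" for a b y j
  proof -
    have "a * y \<in> A j" "b * (t * y) \<in> A j" using that DA tA by auto
    then show ?thesis by (simp add: A_def distrib_left distrib_right mult.assoc)
  qed
  have "prod_list xs \<in> A j"
    if "set xs \<subseteq> {a + b * t | a b. a \<in> D \<and> b \<in> D}" "j + length xs = m" for xs j
    using that
  proof (induction xs arbitrary: j)
    case Nil
    then show ?case using D by (simp add: A_def products_vanish_def)
  next
    case (Cons x xs)
    then have "prod_list xs \<in> A (Suc j)" by simp
    moreover obtain a b where "a \<in> D" "b \<in> D" "x = a + b * t" using Cons.prems by auto
    ultimately show ?case using KA by simp
  qed
  \<comment> \<open>\<open>A 0\<close> contains only 0, because the empty product is 1.\<close>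
  from this[of _ 0] show ?thesis by (simp add: A_def products_vanish_def)
qed

lemma keys_mult_mem:
  fixes x y :: "('r::ring_1, 'g::group_add) group_ring"
  assumes "is_subgroup N" "Poly_Mapping.keys x \<subseteq> N" "Poly_Mapping.keys y \<subseteq> N"
  shows "Poly_Mapping.keys (x * y) \<subseteq> N"
proof
  fix g assume "g \<in> Poly_Mapping.keys (x * y)"
  then obtain h k where "g = h + k" "h \<in> Poly_Mapping.keys x" "k \<in> Poly_Mapping.keys y"
    using keys_mult[of x y] by blast
  then show "g \<in> N" using assms by (auto simp: is_subgroup_def)
qed

lemma keys_add_mem:
  "Poly_Mapping.keys x \<subseteq> N \<Longrightarrow> Poly_Mapping.keys y \<subseteq> N \<Longrightarrow> Poly_Mapping.keys (x + y) \<subseteq> N"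
  using keys_add[of x y] by auto

lemma keys_conj_mem:
  fixes x :: "('r::ring_1, 'g::group_add) group_ring"
  assumes "\<And>n. n \<in> N \<Longrightarrow> s + n + t \<in> N" "Poly_Mapping.keys x \<subseteq> N"
  shows "Poly_Mapping.keys (Poly_Mapping.single s 1 * x * Poly_Mapping.single t 1) \<subseteq> N"
proof
  fix g assume "g \<in> Poly_Mapping.keys (Poly_Mapping.single s 1 * x * Poly_Mapping.single t 1)"
  then obtain h where "h \<in> Poly_Mapping.keys (Poly_Mapping.single s 1 * x)" "g = h + t"
    using keys_mult[of "Poly_Mapping.single s 1 * x" "Poly_Mapping.single t 1"] by auto
  moreover from this obtain n where "n \<in> Poly_Mapping.keys x" "h = s + n"
    using keys_mult[of "Poly_Mapping.single s 1" x] by auto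
  ultimately show "g \<in> N" using assms by auto
qed

text \<open>\<open>a\<close> is the part of \<open>x\<close> supported on \<open>N\<close>; the rest
  is supported on the coset of \<open>t\<close> and is translated back into \<open>N\<close> by
  \<open>- t\<close>.\<close>

lemma coset_decomposition:
  fixes x :: "('r::ring_1, 'g::group_add) group_ring"
  assumes "Poly_Mapping.keys x \<subseteq> N \<union> (\<lambda>n. n + t) ` N"
  obtains a b where "Poly_Mapping.keys a \<subseteq> N" "Poly_Mapping.keys b \<subseteq> N"
    "x = a + b * Poly_Mapping.single t 1"
proof -
  define a where "a = Poly_Mapping.mapp (\<lambda>g r. r when g \<in> N) x"
  have lookup_a: "Poly_Mapping.lookup a g = (Poly_Mapping.lookup x g when g \<in> N)" for g
    by (simp add: a_def lookup_mapp when_def in_keys_iff)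
  define b where "b = (x - a) * Poly_Mapping.single (- t) 1"
  have "Poly_Mapping.keys a \<subseteq> N"
    by (auto simp: in_keys_iff lookup_a)
  moreover have "Poly_Mapping.keys b \<subseteq> N"
  proof
    fix g assume "g \<in> Poly_Mapping.keys b"
    then obtain h where h: "h \<in> Poly_Mapping.keys (x - a)" "g = h - t"
      using keys_mult[of "x - a" "Poly_Mapping.single (- t) 1"] by (auto simp: b_def)
    then have "h \<in> Poly_Mapping.keys x" "h \<notin> N"
      by (auto simp: in_keys_iff lookup_minus lookup_a when_def split: if_splits)
    then show "g \<in> N" using assms h(2) by auto
  qed
  moreover have "x = a + b * Poly_Mapping.single t 1"
    by (simp add: b_def mult.assoc mult_single)
  ultimately show thesis by (rule that)
qed

text \<open>Modulo the augmentation ideal of a subgroup \<open>N\<close> of index two, an element of the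
  augmentation ideal of \<open>N \<union> (N + t)\<close> is \<open>r (1 - t)\<close>, and a product of \<open>l + 1\<close> of these
  is divisible by \<open>2 ^ l\<close>.\<close>

lemma aug_ideal_prod_list_index_two:
  fixes xs :: "('r::ring_1, 'g::group_add) group_ring list"
  assumes N: "is_subgroup N" "t + t \<in> N" "\<And>x. x \<in> N \<Longrightarrow> t + x - t \<in> N"
    and xs: "set xs \<subseteq> aug_ideal (N \<union> (\<lambda>x. x + t) ` N)" "length xs = Suc l"
  shows "\<exists>a b r. Poly_Mapping.keys a \<subseteq> N \<and> Poly_Mapping.keys b \<subseteq> N \<and>
    prod_list xs = a + b * Poly_Mapping.single t 1 \<and> aug a = 2 ^ l * r \<and> aug b = - (2 ^ l * r)"
  using xs
proof (induction xs arbitrary: l)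
  case (Cons x xs)
  let ?t = "Poly_Mapping.single t (1::'r)" and ?t' = "Poly_Mapping.single (- t) (1::'r)"
  have "x \<in> aug_ideal (N \<union> (\<lambda>x. x + t) ` N)" using Cons.prems by simp
  then obtain a b where ab: "Poly_Mapping.keys a \<subseteq> N" "Poly_Mapping.keys b \<subseteq> N"
    "x = a + b * ?t" "aug a + aug b = 0"
    by (auto simp: aug_ideal_def aug_add aug_mult elim!: coset_decomposition)
  have augb: "aug b = - aug a" using ab(4) by (simp add: eq_neg_iff_add_eq_0 add.commute)
  show ?case
  proof (cases l)
    case 0
    then show ?thesis using ab augb Cons.prems(2) by auto
  next
    case (Suc k)
    then obtain p q r where pq: "Poly_Mapping.keys p \<subseteq> N" "Poly_Mapping.keys q \<subseteq> N"
      "prod_list xs = p + q * ?t" "aug p = 2 ^ k * r" "aug q = - (2 ^ k * r)"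
      using Cons.IH[of k] Cons.prems by auto
    define p' where "p' = ?t * p * ?t'"
    define q' where "q' = ?t * q * ?t'"
    have keys': "Poly_Mapping.keys p' \<subseteq> N" "Poly_Mapping.keys q' \<subseteq> N"
      unfolding p'_def q'_def
      using N(3) pq keys_conj_mem[of N t "- t" p] keys_conj_mem[of N t "- t" q] by simp_all
    have aug': "aug p' = aug p" "aug q' = aug q"
      by (simp_all add: p'_def q'_def aug_mult)
    have swap: "?t * p = p' * ?t" "?t * q = q' * ?t"
      by (simp_all add: p'_def q'_def mult.assoc mult_single)
    \<comment> \<open>Moving \<open>t\<close> to the right past \<open>p\<close> and
      \<open>q\<close> conjugates them to \<open>p'\<close> and \<open>q'\<close>; the square of
      \<open>t\<close> is absorbed into the \<open>N\<close>-part because \<open>t + t\<close> lies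
      in \<open>N\<close>.\<close>
    let ?a = "a * p + b * q' * Poly_Mapping.single (t + t) 1" and ?b = "a * q + b * p'"
    have "(a + b * ?t) * (p + q * ?t) = a * p + a * q * ?t + b * (?t * p) + b * (?t * q) * ?t"
      by (simp add: distrib_left distrib_right mult.assoc add.assoc)
    also have "\<dots> = a * p + a * q * ?t + b * p' * ?t + b * q' * (?t * ?t)"
      unfolding swap by (simp add: mult.assoc)
    also have "\<dots> = ?a + ?b * ?t"
      by (simp add: mult_single distrib_right add_ac)
    finally have "prod_list (x # xs) = ?a + ?b * ?t"
      using ab(3) pq(3) by simp
    moreover have "Poly_Mapping.keys ?a \<subseteq> N" "Poly_Mapping.keys ?b \<subseteq> N"
      using N(2) ab(1,2) pq(1,2) keys' by (intro keys_add_mem keys_mult_mem[OF N(1)]; simp)+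
    \<comment> \<open>Both summands of \<open>aug ?a\<close> equal
      \<open>aug a * (2 ^ k * r)\<close>, and both summands of \<open>aug ?b\<close> are its
      negative. As 2 is central, the doubling raises \<open>2 ^ k\<close> to
      \<open>2 ^ l\<close>.\<close>
    moreover have "aug a * (2 ^ k * r) = 2 ^ k * (aug a * r)"
      using power_commuting_commutes[of 2 "aug a" k]
      by (simp add: mult_2 mult_2_right flip: mult.assoc)
    then have "aug ?a = 2 ^ l * (aug a * r)" "aug ?b = - (2 ^ l * (aug a * r))"
      by (simp_all add: aug_add aug_mult pq aug' augb Suc mult.assoc mult_2 distrib_right)
    ultimately show ?thesis by blast
  qed
qed simp

text \<open>With \<open>2 ^ k = 0\<close> in the coefficients, a product of \<open>k + 1\<close>
  factors is \<open>a + b t\<close> with \<open>a\<close> and \<open>b\<close> of augmentation 0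
  over the index-two subgroup \<open>N\<close>. Products of \<open>m\<close> such elements vanish if
  those of \<open>m\<close> elements of \<open>aug_ideal N\<close> do, so \<open>(k + 1) * m\<close>
  factors suffice for \<open>H\<close>.\<close>

lemma aug_ideal_two_group:
  fixes H :: "'g::group_add set"
  assumes H: "is_subgroup H" "finite H" "card H = 2 ^ n" and two: "(2::'r::ring_1) \<in> ring_nil"
  shows "\<exists>m. products_vanish m (aug_ideal H :: ('r, 'g) group_ring set)"
  using H
proof (induction n arbitrary: H)
  case 0
  then have "H = {0}" by (auto simp: is_subgroup_def card_1_singleton_iff)
  then have "x = 0" if "x \<in> aug_ideal H" for x :: "('r, 'g) group_ring"
  proof -
    have "Poly_Mapping.lookup x g = 0" if "g \<noteq> 0" for g
      using that \<open>x \<in> aug_ideal H\<close> \<open>H = {0}\<close> by (auto simp: aug_ideal_def in_keys_iff)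
    then have "x = Poly_Mapping.single 0 (Poly_Mapping.lookup x 0)"
      by (intro poly_mapping_eqI) (simp add: lookup_single when_def)
    moreover have "aug x = 0" using that by (simp add: aug_ideal_def)
    ultimately show ?thesis by (metis aug_single single_zero)
  qed
  then have "products_vanish 1 (aug_ideal H :: ('r, 'g) group_ring set)"
    by (auto simp: products_vanish_def length_Suc_conv)
  then show ?case by blast
next
  case (Suc n)
  obtain N t where N: "is_subgroup N" "card N = 2 ^ n" "N \<subseteq> H" "t \<in> H" "t + t \<in> N"
    "H = N \<union> (\<lambda>x. x + t) ` N" "\<And>x. x \<in> N \<Longrightarrow> t + x - t \<in> N" "\<And>x. x \<in> N \<Longrightarrow> - t + x + t \<in> N"
    using index_two_subgroup[OF Suc.prems] by metis
  obtain m where m: "products_vanish m (aug_ideal N :: ('r, 'g) group_ring set)"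
    using Suc.IH[OF N(1) finite_subset[OF N(3) Suc.prems(2)] N(2)] by blast
  obtain k where k: "(2::'r) ^ k = 0" using two by (auto simp: ring_nil_def)
  let ?K = "{a + b * Poly_Mapping.single t 1 | a b. a \<in> aug_ideal N \<and> b \<in> aug_ideal N}
    :: ('r, 'g) group_ring set"
  have "products_vanish m ?K"
  proof (rule products_vanish_extend[OF m])
    show "Poly_Mapping.single t 1 * Poly_Mapping.single (- t) 1 = (1 :: ('r, 'g) group_ring)"
      by (simp add: mult_single)
    show "Poly_Mapping.single (- t) 1 * x * Poly_Mapping.single t 1 \<in> aug_ideal N" if "x \<in> aug_ideal N"
      for x :: "('r, 'g) group_ring"
      using that keys_conj_mem[OF N(8), of x] by (simp add: aug_ideal_def aug_mult)
  qed
  moreover have "prod_list xs \<in> ?K" if "set xs \<subseteq> aug_ideal H" "length xs = Suc k"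
    for xs :: "('r, 'g) group_ring list"
    using aug_ideal_prod_list_index_two[OF N(1,5,7), of xs k] that N(6) k
    by (auto simp: aug_ideal_def)
  ultimately have "products_vanish (Suc k * m) (aug_ideal H :: ('r, 'g) group_ring set)"
    by (rule products_vanish_blocks)
  then show ?case by blast
qed

text \<open>The support of \<open>x\<close> generates a finite subgroup, whose order is a power of
  2; nilpotency of its augmentation ideal is applied to a constant list.\<close>

lemma aug_zero_nil:
  fixes x :: "('r::ring_1, 'g::group_add) group_ring"
  assumes "locally_finite_group TYPE('g)" "two_group TYPE('g)" "(2::'r) \<in> ring_nil" "aug x = 0"
  shows "x \<in> ring_nil"
proof -
  let ?H = "is_subgroup hull Poly_Mapping.keys x"
  have "finite ?H" using assms(1) by (simp add: locally_finite_group_def)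
  moreover obtain n where "card ?H = 2 ^ n"
    using card_two_subgroup[OF is_subgroup_hull \<open>finite ?H\<close>] assms(2) by (auto simp: two_group_def)
  ultimately obtain m where m: "products_vanish m (aug_ideal ?H :: ('r, 'g) group_ring set)"
    using aug_ideal_two_group[OF is_subgroup_hull _ _ assms(3)] by blast
  have "x \<in> aug_ideal ?H" using assms(4) hull_subset[of "Poly_Mapping.keys x" is_subgroup]
    by (simp add: aug_ideal_def)
  then have "set (replicate m x) \<subseteq> aug_ideal ?H" by auto
  then have "prod_list (replicate m x) = 0"
    using m by (metis products_vanish_def length_replicate)
  then show ?thesis by (auto simp: ring_nil_def)
qed

subsection \<open>CUNC group rings\<close>

lemma single_power:
  "Poly_Mapping.single g (r::'r::ring_1) ^ n = Poly_Mapping.single (((+) g ^^ n) (0::'g::group_add)) (r ^ n)"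
  by (induction n) (simp_all add: mult_single)

lemma central_single:
  fixes x :: "('r::ring_1, 'g::group_add) group_ring"
  assumes "\<And>s. r * s = s * r"
  shows "Poly_Mapping.single 0 r * x = x * Poly_Mapping.single 0 r"
  using assms
  by (induction x rule: group_ring_induct) (simp_all add: mult_single distrib_left distrib_right)

section \<open>From the group ring to its coefficients and its group\<close>

text \<open>\<open>R\<close> embeds into \<open>RG\<close> by \<open>single 0\<close>, and
  \<open>aug\<close> is a retraction: units and idempotents are carried up, nilpotency and
  commutation are carried down.\<close>

lemma CUNC_group_ring_coefficients:
  assumes "CUNC_ring TYPE(('r::ring_1, 'g::group_add) group_ring)"
  shows "CUNC_ring TYPE('r)"
  unfolding CUNC_ring_iff
proof (intro conjI ballI allI)
  let ?i = "Poly_Mapping.single 0 :: 'r \<Rightarrow> ('r, 'g) group_ring"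
  have RG: "\<And>u :: ('r, 'g) group_ring. u \<in> ring_units \<Longrightarrow> u - 1 \<in> ring_nil"
    "\<And>e x :: ('r, 'g) group_ring. e \<in> ring_idem \<Longrightarrow> e * x = x * e"
    using assms unfolding CUNC_ring_iff by blast+
  fix u :: 'r assume "u \<in> ring_units"
  then obtain v where "u * v = 1" "v * u = 1" by (auto simp: ring_units_def)
  then have "?i u * ?i v = 1" "?i v * ?i u = 1" by (simp_all add: mult_single)
  then have "?i u - 1 \<in> ring_nil" using RG(1) by (auto simp: ring_units_def)
  then obtain n where "(?i u - ?i 1) ^ n = 0" by (auto simp: ring_nil_def)
  then have "aug ((?i u - ?i 1) ^ n) = 0" by simp
  then have "(u - 1) ^ n = 0" by (simp add: aug_power aug_diff del: single_one)
  then show "u - 1 \<in> ring_nil" by (auto simp: ring_nil_def)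
next
  let ?i = "Poly_Mapping.single 0 :: 'r \<Rightarrow> ('r, 'g) group_ring"
  fix e x :: 'r assume "e \<in> ring_idem"
  then have "?i e \<in> ring_idem" by (simp add: ring_idem_def mult_single)
  then have "?i e * ?i x = ?i x * ?i e" using assms unfolding CUNC_ring_iff by blast
  then show "e * x = x * e" by (metis aug_mult aug_single)
qed

lemma unipotent_power_two:
  fixes x :: "'a::ring_1"
  shows "\<exists>y. x ^ 2 ^ n - 1 = (x - 1) ^ 2 ^ n + 2 * y"
proof (induction n)
  case 0
  show ?case by (rule exI[of _ 0]) simp
next
  case (Suc n)
  then obtain y where y: "x ^ 2 ^ n - 1 = (x - 1) ^ 2 ^ n + 2 * y" by blast
  let ?z = "x ^ 2 ^ n - 1" and ?u = "(x - 1) ^ 2 ^ n"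
  have sq: "w ^ 2 ^ Suc n = w ^ 2 ^ n * w ^ 2 ^ n" for w :: 'a
    by (simp add: mult_2 power_add)
  \<comment> \<open>This is the square of \<open>1 + ?z\<close>, minus 1.\<close>
  have "x ^ 2 ^ Suc n - 1 = ?z * ?z + 2 * ?z"
    unfolding sq by (simp add: algebra_simps mult_2)
  also have "?z * ?z = ?u * ?u + 2 * (?u * y + y * ?u + 2 * (y * y))"
    unfolding y by (simp add: algebra_simps mult_2 mult_2_right)
  finally have "x ^ 2 ^ Suc n - 1 = (x - 1) ^ 2 ^ Suc n + 2 * (?u * y + y * ?u + 2 * (y * y) + ?z)"
    unfolding sq by (simp add: distrib_left add.assoc)
  then show ?case by blast
qed

lemma CUNC_group_ring_two_group:
  assumes cunc: "CUNC_ring TYPE(('r::ring_1, 'g::group_add) group_ring)"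
  shows "two_group TYPE('g)"
  unfolding two_group_def
proof
  fix g :: 'g
  let ?x = "Poly_Mapping.single g 1 :: ('r, 'g) group_ring"
  have "CUNC_ring TYPE('r)" using cunc by (rule CUNC_group_ring_coefficients)
  then have "(2::'r) \<in> ring_nil" unfolding CUNC_ring_iff by (blast intro: two_nil)
  then obtain k where k: "(2::'r) ^ k = 0" by (auto simp: ring_nil_def)
  have "?x * Poly_Mapping.single (- g) 1 = 1" "Poly_Mapping.single (- g) 1 * ?x = 1"
    by (simp_all add: mult_single)
  then have "?x \<in> ring_units" by (auto simp: ring_units_def)
  then have "?x - 1 \<in> ring_nil" using cunc unfolding CUNC_ring_iff by blast
  then obtain n where "(?x - 1) ^ n = 0" by (auto simp: ring_nil_def)
  \<comment> \<open>The exponent \<open>n\<close> may be raised to \<open>2 ^ n\<close>, the form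
    needed for the congruence modulo 2.\<close>
  then have "(?x - 1) ^ 2 ^ n = 0" by (rule ring_nil_power_ge) simp
  then obtain y where y: "?x ^ 2 ^ n - 1 = 2 * y"
    using unipotent_power_two[of ?x n] by auto
  have "((+) g ^^ 2 ^ n) 0 = 0"
  proof (rule ccontr)
    let ?h = "((+) g ^^ 2 ^ n) 0"
    assume h: "?h \<noteq> 0"
    have "Poly_Mapping.lookup (?x ^ 2 ^ n - 1) ?h = 1"
      using h by (simp add: single_power lookup_minus lookup_one)
    then have "1 = 2 * Poly_Mapping.lookup y ?h"
      unfolding y by (simp add: mult_2 lookup_add)
    \<comment> \<open>Comparing coefficients at \<open>?h\<close> made 2 invertible on the right.
      Multiplying by that inverse lowers the exponent step by step, down to
      \<open>1 = 0\<close>.\<close>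
    have "(2::'r) ^ j = 0 \<Longrightarrow> False" for j
    proof (induction j)
      case (Suc j)
      have "2 ^ Suc j * Poly_Mapping.lookup y ?h = 2 ^ j"
        using \<open>1 = 2 * Poly_Mapping.lookup y ?h\<close> by (simp only: power_Suc2 mult.assoc) simp
      then show ?case using Suc by simp
    qed simp
    then show False using k by blast
  qed
  then have "element_order g dvd 2 ^ n" by (simp add: funpow_add_eq_0_iff)
  then show "\<exists>k. element_order g = 2 ^ k"
    using divides_primepow_nat[OF two_is_prime_nat] by blast
qed

section \<open>From coefficients and group to the group ring\<close>

text \<open>The difference \<open>d\<close> of commuting idempotents satisfies
  \<open>d ^ 3 = d\<close>, so all its odd powers equal \<open>d\<close>; a nilpotent such
  \<open>d\<close> is 0.\<close>

lemma eq_if_commuting_idem_diff_nil: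
  fixes e f :: "'a::ring_1"
  assumes "e * e = e" "f * f = f" "e * f = f * e" "e - f \<in> ring_nil"
  shows "e = f"
proof -
  let ?d = "e - f"
  obtain n where n: "?d ^ n = 0" using assms by (auto simp: ring_nil_def)
  have "e * (f * z) = f * (e * z)" "e * (e * z) = e * z" "f * (f * z) = f * z" for z
    using assms(1-3) by (metis mult.assoc)+
  then have d3: "?d * (?d * ?d) = ?d"
    using assms(1-3) by (simp add: left_diff_distrib right_diff_distrib)
  have "?d ^ Suc (2 * j) = ?d" for j
  proof (induction j)
    case (Suc j)
    have "?d ^ Suc (2 * Suc j) = ?d * (?d * ?d ^ Suc (2 * j))" by simp
    then show ?case unfolding Suc d3 .
  qed simp
  moreover have "?d ^ Suc (2 * n) = 0" using n by (rule ring_nil_power_ge) simp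
  ultimately show ?thesis by (metis eq_iff_diff_eq_0)
qed

lemma CUNC_group_ring_if:
  assumes lf: "locally_finite_group TYPE('g::group_add)"
    and R: "CUNC_ring TYPE('r::ring_1)" and G: "two_group TYPE('g)"
  shows "CUNC_ring TYPE(('r, 'g) group_ring)"
  unfolding CUNC_ring_iff
proof (intro conjI ballI allI)
  have two: "(2::'r) \<in> ring_nil" using R unfolding CUNC_ring_iff by (blast intro: two_nil)
  note nil = aug_zero_nil[OF lf G two]
  fix u :: "('r, 'g) group_ring" assume "u \<in> ring_units"
  then obtain v where "u * v = 1" "v * u = 1" by (auto simp: ring_units_def)
  then have "aug u * aug v = 1" "aug v * aug u = 1" by (metis aug_mult aug_one)+
  then have "aug u \<in> ring_units" by (auto simp: ring_units_def)
  then have "aug u - 1 \<in> ring_nil" using R unfolding CUNC_ring_iff by blast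
  then obtain n where "(aug u - 1) ^ n = 0" by (auto simp: ring_nil_def)
  \<comment> \<open>Only a power of \<open>u - 1\<close> is known to have augmentation 0; that power
    is nilpotent, hence so is \<open>u - 1\<close>.\<close>
  then have "aug ((u - 1) ^ n) = 0" by (simp add: aug_power aug_diff)
  then have "(u - 1) ^ n \<in> ring_nil" by (rule nil)
  then show "u - 1 \<in> ring_nil" by (auto simp: ring_nil_def simp flip: power_mult)
next
  have two: "(2::'r) \<in> ring_nil" using R unfolding CUNC_ring_iff by (blast intro: two_nil)
  note nil = aug_zero_nil[OF lf G two]
  fix e x :: "('r, 'g) group_ring" assume "e \<in> ring_idem"
  then have e: "e * e = e" by (simp add: ring_idem_def)
  \<comment> \<open>\<open>?f\<close> is the augmentation of \<open>e\<close> as a scalar. It is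
    central because idempotents of \<open>R\<close> are, and it differs from \<open>e\<close> by an
    element of augmentation 0.\<close>
  let ?f = "Poly_Mapping.single 0 (aug e) :: ('r, 'g) group_ring"
  have idem: "aug e * aug e = aug e" using e by (metis aug_mult)
  then have "aug e \<in> ring_idem" by (simp add: ring_idem_def)
  then have "aug e * r = r * aug e" for r
    using R unfolding CUNC_ring_iff by blast
  then have central: "?f * y = y * ?f" for y by (rule central_single)
  have "e - ?f \<in> ring_nil" by (rule nil) (simp add: aug_diff)
  moreover have "?f * ?f = ?f" by (simp add: mult_single idem)
  ultimately have "e = ?f"
    using eq_if_commuting_idem_diff_nil[OF e _ central[of e, symmetric]] by blast
  then show "e * x = x * e" using central[of x] by (simp only: \<open>e = ?f\<close>[symmetric])
qed

theorem theorem4p4: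
  assumes "locally_finite_group TYPE('g::group_add)"
  shows "CUNC_ring TYPE(('r::ring_1, 'g) group_ring) \<longleftrightarrow>
    CUNC_ring TYPE('r) \<and> two_group TYPE('g)"
  using assms CUNC_group_ring_coefficients CUNC_group_ring_two_group CUNC_group_ring_if by blast

end
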